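(* For $i=1,2$ let $G_{i}$ be an $r_{i}$-regular graph of order $p_{i}$ with adjacency spectrum $\{r_{i},\lambda_{i_{2}},\ldots,\lambda_{i_{p_{i}}}\}$. Then the distance spectrum of the subdivision-vertex join $G_{1}\dot{\vee}G_{2}$ consists of: (1) $-2(\lambda_{1_{j}}+r_{1}+1)$, $j=2,\ldots,p_{1}$; (2) $-2(\lambda_{2_{j}}+r_{2}+1)$, $j=2,\ldots,p_{2}$; (3) $0$ with multiplicity $\frac{1}{2}r_{1}p_{1}+\frac{1}{2}r_{2}p_{2}-2$; (4) the four eigenvalues of the matrix $$\begin{bmatrix} 2p_{1}-2 & \frac{3}{2}r_{1}p_{1}-2r_{1} & p_{2} & r_{2}p_{2}\\ 3p_{1}-4 & 2r_{1}p_{1}-4r_{1} & 2p_{2} & \frac{3}{2}r_{2}p_{2}\\ p_{1} & r_{1}p_{1} & 2p_{2}-2 & \frac{3}{2}r_{2}p_{2}-2r_{2}\\ 2p_{1} & \frac{3}{2}r_{1}p_{1} & 3p_{2}-4 & 2r_{2}p_{2}-4r_{2}\end{bmatrix}.$$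
   Context: The subdivision graph $S(G)$ is obtained from $G$ by inserting a new vertex into every edge; $I(G)$ denotes the set of these new vertices, and $V(G)$ the original vertices. The subdivision-vertex join $G_1\dot{\vee}G_2$ of vertex-disjoint graphs is obtained from $S(G_1)$ and $S(G_2)$ by joining each vertex of $V(G_1)$ with every vertex of $V(G_2)$. The distance spectrum of a connected graph is the multiset of eigenvalues of its distance matrix. *)

theory Defs
  imports "Jordan_Normal_Form.Char_Poly" Complex_Main
begin

record 'v graph =
  verts :: "'v set"
  edges :: "'v set set"

definition simple_graph :: "'v graph \<Rightarrow> bool" where
  "simple_graph G \<longleftrightarrow>
     finite (verts G) \<and> verts G \<noteq> {} \<and> (\<forall>e\<in>edges G. e \<subseteq> verts G \<and> card e = 2)"

definition regular :: "nat \<Rightarrow> 'v graph \<Rightarrow> bool" where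
  "regular r G \<longleftrightarrow> (\<forall>v\<in>verts G. card {e \<in> edges G. v \<in> e} = r)"

definition adj :: "'v graph \<Rightarrow> ('v \<times> 'v) set" where
  "adj G = {(u, v). {u, v} \<in> edges G}"

text \<open>The least length of a walk from \<open>u\<close> to \<open>v\<close>; only meaningful if there is such a walk,
  in particular whenever the graph is connected and \<open>u\<close>, \<open>v\<close> are vertices.\<close>
definition graph_dist :: "'v graph \<Rightarrow> 'v \<Rightarrow> 'v \<Rightarrow> nat" where
  "graph_dist G u v = (LEAST n. (u, v) \<in> adj G ^^ n)"

text \<open>\<open>Inl v\<close> is an original vertex, \<open>Inr e\<close> the vertex inserted into the edge \<open>e\<close>.\<close>
definition subdivision_graph :: "'v graph \<Rightarrow> ('v + 'v set) graph" where
  "subdivision_graph G =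
     \<lparr>verts = verts G <+> edges G,
      edges = {{Inl v, Inr e} | v e. e \<in> edges G \<and> v \<in> e}\<rparr>"

text \<open>Vertex-disjointness of the two graphs is built in through the outer sum type.\<close>
definition subdivision_vertex_join ::
  "'a graph \<Rightarrow> 'b graph \<Rightarrow> (('a + 'a set) + ('b + 'b set)) graph" where
  "subdivision_vertex_join G1 G2 =
     \<lparr>verts = verts (subdivision_graph G1) <+> verts (subdivision_graph G2),
      edges = (image Inl) ` edges (subdivision_graph G1)
            \<union> (image Inr) ` edges (subdivision_graph G2)
            \<union> {{Inl (Inl u), Inr (Inl v)} | u v. u \<in> verts G1 \<and> v \<in> verts G2}\<rparr>"

text \<open>Eigenvalues with algebraic multiplicity, taken over the complex numbers.\<close>
definition eigenvalue_mset :: "real mat \<Rightarrow> complex multiset" where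
  "eigenvalue_mset A = proots (char_poly (map_mat complex_of_real A))"

definition vertex_matrix :: "('v \<Rightarrow> 'v \<Rightarrow> real) \<Rightarrow> 'v list \<Rightarrow> real mat" where
  "vertex_matrix f vs = mat (length vs) (length vs) (\<lambda>(i, j). f (vs ! i) (vs ! j))"

text \<open>The vertices are listed in an arbitrary order; by \<open>vertex_matrix_spectrum_unique\<close> below the
  eigenvalues do not depend on it.\<close>
definition vertex_spectrum :: "('v \<Rightarrow> 'v \<Rightarrow> real) \<Rightarrow> 'v set \<Rightarrow> complex multiset" where
  "vertex_spectrum f V =
     eigenvalue_mset (vertex_matrix f (SOME vs. distinct vs \<and> set vs = V))"

definition adjacency_spectrum :: "'v graph \<Rightarrow> complex multiset" where
  "adjacency_spectrum G = vertex_spectrum (\<lambda>u v. if {u, v} \<in> edges G then 1 else 0) (verts G)"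

definition distance_spectrum :: "'v graph \<Rightarrow> complex multiset" where
  "distance_spectrum G = vertex_spectrum (\<lambda>u v. real (graph_dist G u v)) (verts G)"

lemma vertex_matrix_spectrum_unique:
  assumes vs: "distinct vs" and ws: "distinct ws" and eq: "set vs = set ws"
  shows "eigenvalue_mset (vertex_matrix f vs) = eigenvalue_mset (vertex_matrix f ws)"
proof -
  define n where "n = length vs"
  have n': "length ws = n" using assms by (metis distinct_card n_def)
  define P :: "complex mat" where
    "P = mat n n (\<lambda>(i, j). if vs ! i = ws ! j then 1 else 0)"
  define Q :: "complex mat" where
    "Q = mat n n (\<lambda>(i, j). if ws ! i = vs ! j then 1 else 0)"
  let ?A = "map_mat complex_of_real (vertex_matrix f vs)"
  let ?B = "map_mat complex_of_real (vertex_matrix f ws)"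
  have sel: "(\<Sum>k = 0..<n. (if x = us ! k then 1 else 0) * g (us ! k)) = g x"
    if "distinct us" "length us = n" "x \<in> set us" for us x and g :: "'a \<Rightarrow> complex"
  proof -
    have "(\<Sum>k = 0..<n. (if x = us ! k then 1 else 0) * g (us ! k))
        = (\<Sum>y\<in>set us. (if x = y then 1 else 0) * g y)"
      by (rule sum.reindex_bij_betw[of "(!) us"])
         (use that in \<open>auto simp: bij_betw_nth atLeast0LessThan\<close>)
    also have "\<dots> = (\<Sum>y\<in>set us. if x = y then g y else 0)"
      by (rule sum.cong) auto
    also have "\<dots> = g x" using that by simp
    finally show ?thesis .
  qed
  have mem: "vs ! i \<in> set ws" "ws ! i \<in> set vs" "vs ! i \<in> set vs" "ws ! i \<in> set ws"
    if "i < n" for i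
    using nth_mem[of i vs] nth_mem[of i ws] that eq n' n_def by simp_all
  have PQ: "P * Q = 1\<^sub>m n"
  proof (rule eq_matI)
    fix i j assume ij: "i < dim_row (1\<^sub>m n :: complex mat)" "j < dim_col (1\<^sub>m n :: complex mat)"
    have "(P * Q) $$ (i, j)
        = (\<Sum>k = 0..<n. (if vs ! i = ws ! k then 1 else 0) * (if ws ! k = vs ! j then 1 else 0))"
      using ij by (simp add: P_def Q_def scalar_prod_def)
    also have "\<dots> = (if vs ! i = vs ! j then 1 else 0)"
      using ij by (intro sel[OF ws n', where g = "\<lambda>y. if y = vs ! j then 1 else 0"] mem) simp
    finally show "(P * Q) $$ (i, j) = 1\<^sub>m n $$ (i, j)"
      using ij by (simp add: nth_eq_iff_index_eq[OF vs] n_def[symmetric])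
  qed (simp_all add: P_def Q_def)
  have QP: "Q * P = 1\<^sub>m n"
    by (rule mat_mult_left_right_inverse[OF _ _ PQ]) (simp_all add: P_def Q_def)
  have B: "?B \<in> carrier_mat n n" by (simp add: vertex_matrix_def n')
  have A: "?A \<in> carrier_mat n n" by (simp add: vertex_matrix_def n_def)
  have P: "P \<in> carrier_mat n n" and Q: "Q \<in> carrier_mat n n" by (auto simp: P_def Q_def)
  let ?C = "mat n n (\<lambda>(i, j). complex_of_real (f (vs ! i) (ws ! j)))"
  have PB: "P * ?B = ?C"
  proof (rule eq_matI)
    fix i j assume ij: "i < dim_row ?C" "j < dim_col ?C"
    have "(P * ?B) $$ (i, j)
        = (\<Sum>k = 0..<n. (if vs ! i = ws ! k then 1 else 0) * complex_of_real (f (ws ! k) (ws ! j)))"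
      using ij by (simp add: P_def vertex_matrix_def scalar_prod_def n')
    also have "\<dots> = complex_of_real (f (vs ! i) (ws ! j))"
      using ij by (intro sel[OF ws n', where g = "\<lambda>y. complex_of_real (f y (ws ! j))"] mem) simp
    finally show "(P * ?B) $$ (i, j) = ?C $$ (i, j)"
      using ij by simp
  qed (simp_all add: P_def vertex_matrix_def n')
  have AP: "?A * P = ?C"
  proof (rule eq_matI)
    fix i j assume ij: "i < dim_row ?C" "j < dim_col ?C"
    have "(?A * P) $$ (i, j)
        = (\<Sum>k = 0..<n. complex_of_real (f (vs ! i) (vs ! k)) * (if vs ! k = ws ! j then 1 else 0))"
      using ij by (simp add: P_def vertex_matrix_def scalar_prod_def n_def[symmetric])
    also have "\<dots>
        = (\<Sum>k = 0..<n. (if ws ! j = vs ! k then 1 else 0) * complex_of_real (f (vs ! i) (vs ! k)))"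
      by (rule sum.cong) simp_all
    also have "\<dots> = complex_of_real (f (vs ! i) (ws ! j))"
      using ij by (intro sel[OF vs n_def[symmetric],
          where g = "\<lambda>y. complex_of_real (f (vs ! i) y)"] mem) simp
    finally show "(?A * P) $$ (i, j) = ?C $$ (i, j)"
      using ij by simp
  qed (simp_all add: P_def vertex_matrix_def n_def)
  have "?A = ?A * (P * Q)" using A by (simp add: PQ)
  also have "\<dots> = ?A * P * Q" using A P Q by (simp add: assoc_mult_mat[of _ n n _ n _ n])
  also have "\<dots> = P * ?B * Q" by (simp add: AP PB)
  finally have "?A = P * ?B * Q" .
  hence "similar_mat_wit ?A ?B P Q"
    using similar_mat_witI[OF PQ QP _ A B P Q] by simp
  hence "similar_mat ?A ?B" unfolding similar_mat_def by blast
  thus ?thesis unfolding eigenvalue_mset_def by (simp add: char_poly_similar)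
qed

end

theory Submission
  imports Defs "Jordan_Normal_Form.Schur_Decomposition"
begin

text \<open>Call the ends of an original vertex the vertex itself and the ends of an inserted vertex the
  two end points of its edge. In the join, \<open>d(x, y)\<close> is a constant depending only on the blocks of
  \<open>x\<close> and \<open>y\<close> (the four blocks being the original and inserted vertices of either graph), minus
  twice the number of common ends. Hence the distance matrix is \<open>D = - 2 N N\<^sup>T + U W\<close>, where \<open>U\<close>
  has the four block indicators as columns. By regularity the span of these columns is invariant
  under \<open>- 2 N N\<^sup>T\<close>, say \<open>- 2 N N\<^sup>T U = U S\<close>, and then
  \<open>\<chi>(D) \<chi>(S) = \<chi>(- 2 N N\<^sup>T) \<chi>(S + W U)\<close>, where \<open>S + W U\<close> is the quotient matrix of the theorem.
  Up to zeros, the spectrum of \<open>- 2 N N\<^sup>T\<close> is that of \<open>- 2 N\<^sup>T N\<close>, which is block diagonal with blocks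
  \<open>- 2 ((r\<^sub>i + 1) I + A\<^sub>i)\<close>; the two eigenvalues belonging to \<open>r\<^sub>1\<close>, \<open>r\<^sub>2\<close> are cancelled by \<open>\<chi>(S)\<close>.\<close>

section \<open>Characteristic polynomials\<close>

lemma char_poly_four_block_lower_triangular:
  fixes A :: "'a :: idom mat"
  assumes A: "A \<in> carrier_mat n n" and C: "C \<in> carrier_mat m n" and D: "D \<in> carrier_mat m m"
  shows "char_poly (four_block_mat A (0\<^sub>m n m) C D) = char_poly A * char_poly D"
proof -
  have "char_poly_matrix (four_block_mat A (0\<^sub>m n m) C D)
      = four_block_mat (char_poly_matrix A) (0\<^sub>m n m) (map_mat (\<lambda>a. [:- a:]) C) (char_poly_matrix D)"
    using assms by (intro eq_matI) (auto simp: char_poly_matrix_def)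
  thus ?thesis
    unfolding char_poly_def using A C D
    by (simp add: det_four_block_mat_upper_right_zero[of _ n _ m])
qed

text \<open>Conjugation with the block matrix \<open>(1, U; 0, 1)\<close> turns \<open>(A, 0; W, S + W U)\<close> into
  \<open>(A + U W, 0; W, S)\<close>.\<close>
lemma char_poly_invariant_update:
  fixes A :: "'a :: idom mat"
  assumes A: "A \<in> carrier_mat n n" and U: "U \<in> carrier_mat n m" and W: "W \<in> carrier_mat m n"
    and S: "S \<in> carrier_mat m m" and AU: "A * U = U * S"
  shows "char_poly (A + U * W) * char_poly S = char_poly A * char_poly (S + W * U)"
proof -
  let ?P = "four_block_mat (1\<^sub>m n) U (0\<^sub>m m n) (1\<^sub>m m)"
  let ?R = "four_block_mat (1\<^sub>m n) (- U) (0\<^sub>m m n) (1\<^sub>m m)"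
  let ?X = "four_block_mat A (0\<^sub>m n m) W (S + W * U)"
  let ?Y = "four_block_mat (A + U * W) (0\<^sub>m n m) W S"
  have one: "four_block_mat (1\<^sub>m n) (0\<^sub>m n m) (0\<^sub>m m n) (1\<^sub>m m) = (1\<^sub>m (n + m) :: 'a mat)"
    by (rule eq_matI) auto
  have z: "- 0\<^sub>m m m + 1\<^sub>m m = (1\<^sub>m m :: 'a mat)"
    by (rule eq_matI) auto
  have inv: "U + - U = 0\<^sub>m n m" "- U + U = 0\<^sub>m n m"
    using U by (auto intro!: eq_matI)
  have PR: "?P * ?R = 1\<^sub>m (n + m)"
    by (subst mult_four_block_mat) (use U in \<open>auto simp: one z inv\<close>)
  have RP: "?R * ?P = 1\<^sub>m (n + m)"
    by (subst mult_four_block_mat) (use U in \<open>auto simp: one z inv\<close>)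
  note c = A U W S
  have YP: "?Y * ?P = four_block_mat (A + U * W) ((A + U * W) * U) W (S + W * U)"
    by (subst mult_four_block_mat[of _ n n _ m _ m _ _ n _ m])
       (use c in \<open>auto simp: comm_add_mat[of S m m]\<close>)
  have PX: "?P * ?X = four_block_mat (A + U * W) (U * (S + W * U)) W (S + W * U)"
    by (subst mult_four_block_mat[of _ n n _ m _ m _ _ n _ m]) (use c in auto)
  \<comment> \<open>Here the invariance \<open>AU\<close> enters: it makes the upper right blocks of
    \<open>?Y * ?P\<close> and \<open>?P * ?X\<close> agree, so \<open>?P\<close> intertwines
    \<open>?X\<close> and \<open>?Y\<close>.\<close>
  have eq: "(A + U * W) * U = U * (S + W * U)"
    using c AU by (simp add: add_mult_distrib_mat[of _ n n] mult_add_distrib_mat[of _ n m _ m])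
  have X: "?X \<in> carrier_mat (n + m) (n + m)" and Y: "?Y \<in> carrier_mat (n + m) (n + m)"
    and P: "?P \<in> carrier_mat (n + m) (n + m)" and R: "?R \<in> carrier_mat (n + m) (n + m)"
    using c by auto
  have "?Y = ?Y * (?P * ?R)" by (simp only: PR right_mult_one_mat[OF Y])
  also have "\<dots> = ?Y * ?P * ?R" by (rule assoc_mult_mat[OF Y P R, symmetric])
  also have "?Y * ?P = ?P * ?X" by (simp only: YP PX eq)
  finally have "?Y = ?P * ?X * ?R" .
  from similar_matI[OF _ PR RP this] have "similar_mat ?Y ?X"
    using X Y P R by blast
  hence "char_poly ?Y = char_poly ?X" by (rule char_poly_similar)
  thus ?thesis
    using c by (simp add: char_poly_four_block_lower_triangular[of _ n _ m])
qed

lemma char_poly_zero_mat: "char_poly (0\<^sub>m n n :: 'a :: idom mat) = monom 1 n"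
proof -
  have "char_poly_matrix (0\<^sub>m n n :: 'a mat) = [:0, 1:] \<cdot>\<^sub>m 1\<^sub>m n"
    by (intro eq_matI) (auto simp: char_poly_matrix_def)
  thus ?thesis by (simp add: char_poly_def det_smult monom_altdef)
qed

text \<open>The case of two zero matrices in \<open>char_poly_invariant_update\<close>: invariance
  is then trivial, and the zero matrices contribute the powers of the variable. This moves the
  spectrum from a large product to a small one.\<close>

lemma char_poly_mult_commute:
  fixes A :: "'a :: idom mat"
  assumes A: "A \<in> carrier_mat n m" and B: "B \<in> carrier_mat m n"
  shows "char_poly (A * B) * monom 1 m = monom 1 n * char_poly (B * A)"
  using char_poly_invariant_update[OF zero_carrier_mat A B zero_carrier_mat] A B
  by (simp add: char_poly_zero_mat)

section \<open>Multisets of roots\<close>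

lemma proots_prod_list_linear: "proots (\<Prod>a\<leftarrow>as. [:- a, 1:]) = mset (as :: complex list)"
proof (induction as)
  case (Cons a as)
  have nz: "(\<Prod>a\<leftarrow>as. [:- a, 1:]) \<noteq> 0"
    by (auto simp: prod_list_zero_iff)
  show ?case using Cons nz by (simp add: proots_mult del: mult_pCons_left)
qed simp

lemma proots_monom: "proots (monom 1 n :: complex poly) = replicate_mset n 0"
proof -
  have "monom 1 n = (\<Prod>a\<leftarrow>replicate n (0::complex). [:- a, 1:])"
    by (simp add: monom_altdef)
  thus ?thesis by (simp only: proots_prod_list_linear mset_replicate)
qed

lemma char_poly_nonzero:
  fixes A :: "complex mat"
  assumes "A \<in> carrier_mat n n" shows "char_poly A \<noteq> 0"
  using degree_monic_char_poly[OF assms] by auto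

text \<open>The Schur basis that makes \<open>A\<close> triangular also makes \<open>a + b A\<close>
  triangular, and the affine map acts entrywise on the diagonal.\<close>

lemma proots_char_poly_affine:
  fixes A :: "complex mat"
  assumes A: "A \<in> carrier_mat n n"
  shows "proots (char_poly (a \<cdot>\<^sub>m 1\<^sub>m n + b \<cdot>\<^sub>m A)) = image_mset (\<lambda>z. a + b * z) (proots (char_poly A))"
proof -
  obtain es where es: "char_poly A = (\<Prod>e\<leftarrow>es. [:- e, 1:])"
    using char_poly_factorized[OF A] by blast
  obtain B P Q where "schur_decomposition A es = (B, P, Q)" by (metis prod_cases3)
  from schur_decomposition[OF A es this]
  have wit: "similar_mat_wit A B P Q" and ut: "upper_triangular B" and dg: "diag_mat B = es"
    by auto
  note w = similar_mat_witD2[OF A wit]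
  let ?A = "a \<cdot>\<^sub>m 1\<^sub>m n + b \<cdot>\<^sub>m A" and ?B = "a \<cdot>\<^sub>m 1\<^sub>m n + b \<cdot>\<^sub>m B"
  have "P * ?B * Q = a \<cdot>\<^sub>m (P * Q) + b \<cdot>\<^sub>m (P * B * Q)"
    using w by (simp add: mult_add_distrib_mat[of _ n n _ n] add_mult_distrib_mat[of _ n n _ _ n]
        mult_smult_distrib[of _ n n _ n] mult_smult_assoc_mat[of _ n n _ n])
  hence "similar_mat ?A ?B"
    using w by (intro similar_matI[of _ _ P Q n]) auto
  hence "char_poly ?A = char_poly ?B" by (rule char_poly_similar)
  also have "\<dots> = (\<Prod>e\<leftarrow>diag_mat ?B. [:- e, 1:])"
    by (rule char_poly_upper_triangular[of _ n])
       (use w ut in \<open>auto simp: upper_triangular_def\<close>)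
  also have "diag_mat ?B = map (\<lambda>z. a + b * z) es"
    unfolding dg[symmetric] diag_mat_def using w by (intro nth_equalityI) auto
  finally show ?thesis by (simp only: es proots_prod_list_linear mset_map)
qed

section \<open>Matrices with labelled rows and columns\<close>

text \<open>Entries are given on vertices rather than on positions, so that matrix products become
  sums over vertex sets and can be evaluated by counting.\<close>

definition indexed_mat :: "'i list \<Rightarrow> 'j list \<Rightarrow> ('i \<Rightarrow> 'j \<Rightarrow> 'a) \<Rightarrow> 'a mat" where
  "indexed_mat is js f = mat (length is) (length js) (\<lambda>(i, j). f (is ! i) (js ! j))"

lemma indexed_mat_carrier [simp]:
  "indexed_mat is js f \<in> carrier_mat (length is) (length js)"
  "dim_row (indexed_mat is js f) = length is" "dim_col (indexed_mat is js f) = length js"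
  by (simp_all add: indexed_mat_def)

lemma indexed_mat_cong:
  assumes "\<And>i j. i \<in> set is \<Longrightarrow> j \<in> set js \<Longrightarrow> f i j = g i j"
  shows "indexed_mat is js f = indexed_mat is js g"
  unfolding indexed_mat_def using assms by (intro eq_matI) auto

lemma indexed_mat_add:
  "indexed_mat is js f + indexed_mat is js g = indexed_mat is js (\<lambda>i j. f i j + g i j)"
  unfolding indexed_mat_def by (intro eq_matI) auto

lemma indexed_mat_mult:
  assumes "distinct js"
  shows "indexed_mat is js f * indexed_mat js ks g
    = indexed_mat is ks (\<lambda>i k. \<Sum>j\<in>set js. f i j * g j k)"
proof (rule eq_matI)
  fix i k
  assume "i < dim_row (indexed_mat is ks (\<lambda>i k. \<Sum>j\<in>set js. f i j * g j k))"
    and "k < dim_col (indexed_mat is ks (\<lambda>i k. \<Sum>j\<in>set js. f i j * g j k))"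
  moreover have "(\<Sum>l = 0..<length js. f x (js ! l) * g (js ! l) y) = (\<Sum>j\<in>set js. f x j * g j y)" for x y
    by (rule sum.reindex_bij_betw[of "(!) js"])
       (use assms in \<open>auto simp: bij_betw_nth atLeast0LessThan\<close>)
  ultimately show "(indexed_mat is js f * indexed_mat js ks g) $$ (i, k)
      = indexed_mat is ks (\<lambda>i k. \<Sum>j\<in>set js. f i j * g j k) $$ (i, k)"
    by (simp add: indexed_mat_def scalar_prod_def)
qed simp_all

text \<open>Replaces the arbitrary choice in \<open>vertex_spectrum\<close> by any convenient
  enumeration.\<close>

lemma vertex_spectrum_eq:
  assumes "distinct vs" "set vs = V"
  shows "vertex_spectrum f V
    = proots (char_poly (indexed_mat vs vs (\<lambda>u v. complex_of_real (f u v))))"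
proof -
  have "\<exists>vs. distinct vs \<and> set vs = V" using assms by blast
  from someI_ex[OF this]
  have "vertex_spectrum f V = eigenvalue_mset (vertex_matrix f vs)"
    unfolding vertex_spectrum_def using assms by (intro vertex_matrix_spectrum_unique) auto
  also have "map_mat complex_of_real (vertex_matrix f vs)
      = indexed_mat vs vs (\<lambda>u v. complex_of_real (f u v))"
    by (intro eq_matI) (auto simp: vertex_matrix_def indexed_mat_def)
  hence "eigenvalue_mset (vertex_matrix f vs) = proots (char_poly (indexed_mat vs vs (\<lambda>u v. complex_of_real (f u v))))"
    by (simp add: eigenvalue_mset_def)
  finally show ?thesis .
qed

lemma indexed_mat_sum_block_diag:
  fixes f :: "'i + 'j \<Rightarrow> 'i + 'j \<Rightarrow> 'a :: zero"
  assumes "\<And>i j. i \<in> set is \<Longrightarrow> j \<in> set js \<Longrightarrow> f (Inl i) (Inr j) = 0"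
    and "\<And>i j. i \<in> set is \<Longrightarrow> j \<in> set js \<Longrightarrow> f (Inr j) (Inl i) = 0"
  defines "ks \<equiv> map Inl is @ map Inr js"
  shows "indexed_mat ks ks f = four_block_mat
    (indexed_mat is is (\<lambda>i i'. f (Inl i) (Inl i'))) (0\<^sub>m (length is) (length js))
    (0\<^sub>m (length js) (length is)) (indexed_mat js js (\<lambda>j j'. f (Inr j) (Inr j')))"
  by (rule eq_matI) (use assms in \<open>auto simp: indexed_mat_def nth_append\<close>)

section \<open>Distances in the subdivision-vertex join\<close>

fun ends :: "('a + 'a set) + ('b + 'b set) \<Rightarrow> ('a + 'b) set" where
  "ends (Inl (Inl u)) = {Inl u}"
| "ends (Inl (Inr e)) = Inl ` e"
| "ends (Inr (Inl u)) = {Inr u}"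
| "ends (Inr (Inr e)) = Inr ` e"

fun block :: "('a + 'a set) + ('b + 'b set) \<Rightarrow> nat" where
  "block (Inl (Inl u)) = 0"
| "block (Inl (Inr e)) = 1"
| "block (Inr (Inl u)) = 2"
| "block (Inr (Inr e)) = 3"

fun original :: "'a + 'b \<Rightarrow> ('a + 'a set) + ('b + 'b set)" where
  "original (Inl u) = Inl (Inl u)"
| "original (Inr u) = Inr (Inl u)"

text \<open>Blocks \<open>2 i\<close> and \<open>2 i + 1\<close> consist of the original and of the inserted vertices of the
  \<open>i\<close>-th graph. A walk between vertices without a common end descends to original vertices
  (one step for each inserted vertex) and reaches the other graph once or twice.\<close>
definition gap :: "nat \<Rightarrow> nat \<Rightarrow> nat" where
  "gap k l = k mod 2 + l mod 2 + (if k div 2 = l div 2 then 2 else 1)"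

text \<open>Closed form for the distance. Distinct vertices with a common end are joined through it,
  at a cost of one step for each inserted vertex among them.\<close>

definition join_dist where
  "join_dist x y = (if x = y then 0 else if ends x \<inter> ends y \<noteq> {}
     then block x mod 2 + block y mod 2 else gap (block x) (block y))"

lemma verts_join:
  "verts (subdivision_vertex_join G1 G2) = (verts G1 <+> edges G1) <+> (verts G2 <+> edges G2)"
  by (simp add: subdivision_vertex_join_def subdivision_graph_def)

lemma adj_join_iff:
  "(x, y) \<in> adj (subdivision_vertex_join G1 G2) \<longleftrightarrow>
     (\<exists>v e. {x, y} = {Inl (Inl v), Inl (Inr e)} \<and> e \<in> edges G1 \<and> v \<in> e)
   \<or> (\<exists>v e. {x, y} = {Inr (Inl v), Inr (Inr e)} \<and> e \<in> edges G2 \<and> v \<in> e)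
   \<or> (\<exists>u v. {x, y} = {Inl (Inl u), Inr (Inl v)} \<and> u \<in> verts G1 \<and> v \<in> verts G2)"
proof -
  have img: "f ` {g v e | v e. P v e} = {f (g v e) | v e. P v e}" for f g P
    by blast
  have "edges (subdivision_vertex_join G1 G2) =
      {{Inl (Inl v), Inl (Inr e)} | v e. e \<in> edges G1 \<and> v \<in> e}
    \<union> {{Inr (Inl v), Inr (Inr e)} | v e. e \<in> edges G2 \<and> v \<in> e}
    \<union> {{Inl (Inl u), Inr (Inl v)} | u v. u \<in> verts G1 \<and> v \<in> verts G2}"
    unfolding subdivision_vertex_join_def subdivision_graph_def
    by (simp add: img)
  thus ?thesis
    by (simp only: adj_def mem_Collect_eq case_prod_conv Un_iff disj_assoc)
qed

text \<open>A potential argument: along an edge \<open>join_dist x\<close> grows by at most one, so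
  by induction no walk from \<open>x\<close> is shorter than \<open>join_dist\<close>.\<close>

lemma join_dist_step:
  assumes "(y, z) \<in> adj (subdivision_vertex_join G1 G2)"
  shows "join_dist x z \<le> Suc (join_dist x y)"
  using assms unfolding adj_join_iff doubleton_eq_iff
  by (cases x rule: block.cases)
     (elim disjE exE conjE; auto simp: join_dist_def gap_def)+

lemma join_dist_le:
  assumes "(x, y) \<in> adj (subdivision_vertex_join G1 G2) ^^ n"
  shows "join_dist x y \<le> n"
  using assms
proof (induction n arbitrary: y)
  case 0
  thus ?case by (simp add: join_dist_def)
next
  case (Suc n)
  then obtain w where "(x, w) \<in> adj (subdivision_vertex_join G1 G2) ^^ n"
    and "(w, y) \<in> adj (subdivision_vertex_join G1 G2)"
    by auto
  thus ?case using Suc.IH[of w] join_dist_step[of w y G1 G2 x] by linarith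
qed

lemma ends_nonempty:
  assumes "simple_graph G1" "simple_graph G2" "x \<in> verts (subdivision_vertex_join G1 G2)"
  shows "ends x \<noteq> {}"
  using assms unfolding verts_join simple_graph_def
  by (cases x rule: ends.cases) fastforce+

lemma ends_subset:
  assumes "simple_graph G1" "simple_graph G2" "x \<in> verts (subdivision_vertex_join G1 G2)"
  shows "ends x \<subseteq> verts G1 <+> verts G2"
  using assms unfolding verts_join simple_graph_def
  by (cases x rule: ends.cases) auto

lemma walk_to_end:
  assumes x: "x \<in> verts (subdivision_vertex_join G1 G2)" and v: "v \<in> ends x"
  shows "(x, original v) \<in> adj (subdivision_vertex_join G1 G2) ^^ (block x mod 2)"
    and "(original v, x) \<in> adj (subdivision_vertex_join G1 G2) ^^ (block x mod 2)"
  using assms by (cases x rule: ends.cases; auto simp: verts_join adj_join_iff)+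

text \<open>Original vertices of different graphs are adjacent. Within one graph, a detour through
  any original vertex of the other one takes two steps, even when \<open>u = v\<close>.\<close>

lemma walk_between_ends:
  assumes G1: "simple_graph G1" and G2: "simple_graph G2"
    and x: "x \<in> verts (subdivision_vertex_join G1 G2)" and y: "y \<in> verts (subdivision_vertex_join G1 G2)"
    and u: "u \<in> ends x" and v: "v \<in> ends y"
  shows "(original u, original v) \<in> adj (subdivision_vertex_join G1 G2)
    ^^ (if block x div 2 = block y div 2 then 2 else 1)"
proof -
  let ?R = "adj (subdivision_vertex_join G1 G2)"
  \<comment> \<open>Nonemptiness of both graphs supplies the turning points of the detours.\<close>
  obtain a b where ab: "a \<in> verts G1" "b \<in> verts G2"
    using G1 G2 unfolding simple_graph_def by blast
  have uv: "u \<in> verts G1 <+> verts G2" "v \<in> verts G1 <+> verts G2"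
    using ends_subset[OF G1 G2] x y u v by blast+
  \<comment> \<open>A vertex lies on the same side as each of its ends, so the claim depends on
    \<open>u\<close> and \<open>v\<close> only.\<close>
  have side: "block x div 2 = (case u of Inl _ \<Rightarrow> 0 | Inr _ \<Rightarrow> 1)"
    "block y div 2 = (case v of Inl _ \<Rightarrow> 0 | Inr _ \<Rightarrow> 1)"
    using u v by (cases x rule: ends.cases; cases y rule: ends.cases; auto)+
  have cross: "(Inl (Inl s), Inr (Inl t)) \<in> ?R" "(Inr (Inl t), Inl (Inl s)) \<in> ?R"
    if "s \<in> verts G1" "t \<in> verts G2" for s t
    using that by (auto simp: adj_join_iff)
  have two: "(Inl (Inl s), Inl (Inl t)) \<in> ?R ^^ 2" if "s \<in> verts G1" "t \<in> verts G1" for s t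
    using cross[of s b] cross[of t b] that ab by (auto simp: numeral_2_eq_2)
  have two': "(Inr (Inl s), Inr (Inl t)) \<in> ?R ^^ 2" if "s \<in> verts G2" "t \<in> verts G2" for s t
    using cross[of a s] cross[of a t] that ab by (auto simp: numeral_2_eq_2)
  show ?thesis
    using uv unfolding side
    by (cases u; cases v) (auto intro: cross two two')
qed

text \<open>The matching upper bound: descend from \<open>x\<close> to an end, cross if no end is
  shared, and climb to \<open>y\<close>.\<close>

lemma join_dist_walk:
  assumes G1: "simple_graph G1" and G2: "simple_graph G2"
    and x: "x \<in> verts (subdivision_vertex_join G1 G2)" and y: "y \<in> verts (subdivision_vertex_join G1 G2)"
  shows "(x, y) \<in> adj (subdivision_vertex_join G1 G2) ^^ join_dist x y"
proof -
  consider "x = y" | "x \<noteq> y" "ends x \<inter> ends y \<noteq> {}" | "x \<noteq> y" "ends x \<inter> ends y = {}" by blast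
  thus ?thesis
  proof cases
    case 1
    thus ?thesis by (simp add: join_dist_def)
  next
    case 2
    then obtain v where v: "v \<in> ends x" "v \<in> ends y" by blast
    from relpow_trans[OF walk_to_end(1)[OF x v(1)] walk_to_end(2)[OF y v(2)]] 2
    show ?thesis by (simp add: join_dist_def)
  next
    case 3
    obtain u v where uv: "u \<in> ends x" "v \<in> ends y"
      using ends_nonempty[OF G1 G2] x y by blast
    from relpow_trans[OF relpow_trans[OF walk_to_end(1)[OF x uv(1)]
        walk_between_ends[OF G1 G2 x y uv]] walk_to_end(2)[OF y uv(2)]]
    show ?thesis using 3 by (simp add: join_dist_def gap_def ac_simps)
  qed
qed

lemma graph_dist_join:
  assumes "simple_graph G1" "simple_graph G2"
    and "x \<in> verts (subdivision_vertex_join G1 G2)" "y \<in> verts (subdivision_vertex_join G1 G2)"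
  shows "graph_dist (subdivision_vertex_join G1 G2) x y = join_dist x y"
  unfolding graph_dist_def
  using join_dist_walk[OF assms] join_dist_le by (rule Least_equality)

section \<open>Counting common ends and incidences\<close>

lemma card_edge_Int:
  assumes "card e = 2" "card f = 2" "e \<noteq> f" "e \<inter> f \<noteq> {}"
  shows "card (e \<inter> f) = 1"
proof -
  have fin: "finite e" "finite f" using assms by (auto intro: card_ge_0_finite)
  have "e \<inter> f \<noteq> e" using assms fin by (metis Int_lower2 card_subset_eq)
  hence "card (e \<inter> f) < 2" using psubset_card_mono[of e "e \<inter> f"] fin assms by auto
  moreover have "card (e \<inter> f) > 0" using assms fin by (simp add: card_gt_0_iff)
  ultimately show ?thesis by simp
qed

text \<open>Removes the case distinction from the distance, which becomes a block constant minus an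
  inner product of incidence vectors. Distinct vertices share at most one end because edges are
  two-element sets, and a vertex shares all its ends with itself: one if original, two if
  inserted.\<close>

lemma join_dist_card:
  assumes "simple_graph G1" "simple_graph G2"
    and "x \<in> verts (subdivision_vertex_join G1 G2)" "y \<in> verts (subdivision_vertex_join G1 G2)"
  shows "join_dist x y + 2 * card (ends x \<inter> ends y) = gap (block x) (block y)"
proof -
  have c: "card (Inl ` e \<inter> Inl ` f) = card (e \<inter> f)" "card (Inr ` e \<inter> Inr ` f) = card (e \<inter> f)" for e f
    by (simp_all add: image_Int[symmetric] card_image)
  have d: "Inl ` e \<inter> Inr ` f = {}" "Inr ` f \<inter> Inl ` e = {}" for e f by auto
  \<comment> \<open>In contrapositive form for use as a destruction rule: the first premise negates
    the equation left over for two inserted vertices with a common end.\<close>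
  have m: "e = f" if "2 * card (e \<inter> f) \<noteq> Suc (Suc 0)" "v \<in> e" "v \<in> f" "card e = 2" "card f = 2"
    for e f :: "'c set" and v
    using card_edge_Int[of e f] that by fastforce
  have m1: "e = f" if "2 * card (e \<inter> f) \<noteq> Suc (Suc 0)" "v \<in> e" "v \<in> f" "e \<in> edges G1" "f \<in> edges G1" for e f v
    using m[OF that(1-3)] that(4,5) assms(1) by (simp add: simple_graph_def)
  have m2: "e = f" if "2 * card (e \<inter> f) \<noteq> Suc (Suc 0)" "v \<in> e" "v \<in> f" "e \<in> edges G2" "f \<in> edges G2" for e f v
    using m[OF that(1-3)] that(4,5) assms(2) by (simp add: simple_graph_def)
  show ?thesis
    using assms unfolding verts_join simple_graph_def
    by (cases x rule: ends.cases; cases y rule: ends.cases)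
       (auto simp: join_dist_def gap_def c d card_image image_Int[symmetric] dest: m1 m2)
qed

text \<open>Double counting of incidences; it later expresses the number of inserted vertices
  through degree and order.\<close>

lemma handshake:
  assumes G: "simple_graph G" and r: "regular r G"
  shows "2 * card (edges G) = r * card (verts G)"
proof -
  have fin: "finite (verts G)" and "edges G \<subseteq> Pow (verts G)"
    using G by (auto simp: simple_graph_def)
  hence finE: "finite (edges G)" by (meson finite_Pow_iff finite_subset)
  have "(\<Sum>v\<in>verts G. card {e \<in> edges G. v \<in> e}) = (\<Sum>e\<in>edges G. card {v \<in> verts G. v \<in> e})"
    using fin finE by (rule sum_multicount_gen) auto
  moreover have "card {v \<in> verts G. v \<in> e} = 2" if "e \<in> edges G" for e
  proof -
    have "{v \<in> verts G. v \<in> e} = e" using G that by (auto simp: simple_graph_def)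
    thus ?thesis using G that by (simp add: simple_graph_def)
  qed
  ultimately show ?thesis using r by (simp add: regular_def mult.commute)
qed

text \<open>Only \<open>{u, v}\<close> itself can contain both elements. Up to the factor -2, this
  turns the off-diagonal entries of \<open>N' * N\<close> within one graph into adjacency
  entries.\<close>

lemma card_edges_containing_pair:
  assumes G: "simple_graph G" and "u \<noteq> v"
  shows "card {e \<in> edges G. u \<in> e \<and> v \<in> e} = (if {u, v} \<in> edges G then 1 else 0)"
proof -
  have eq: "e = {u, v}" if "e \<in> edges G" "u \<in> e" "v \<in> e" for e
  proof -
    have "card e = 2" using that(1) G by (simp add: simple_graph_def)
    moreover from this have "finite e" by (auto intro: card_ge_0_finite)
    moreover have "card {u, v} = 2" "{u, v} \<subseteq> e" using that \<open>u \<noteq> v\<close> by simp_all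
    ultimately show ?thesis by (metis card_subset_eq)
  qed
  show ?thesis
  proof (cases "{u, v} \<in> edges G")
    case True
    hence "{e \<in> edges G. u \<in> e \<and> v \<in> e} = {{u, v}}" using eq by blast
    thus ?thesis using True by simp
  next
    case False
    hence "{e \<in> edges G. u \<in> e \<and> v \<in> e} = {}" using eq by blast
    thus ?thesis using False by (simp only: if_False card.empty)
  qed
qed

section \<open>The distance matrix of the join\<close>

lemma Inl_notin_Inr_image: "Inl u \<notin> Inr ` e" "Inr w \<notin> Inl ` e'"
  by auto

locale regular_pair =
  fixes G1 :: "'a graph" and G2 :: "'b graph" and r1 r2 :: nat
    and us :: "'a list" and ws :: "'b list" and xs :: "(('a + 'a set) + ('b + 'b set)) list"
  assumes G1: "simple_graph G1" and G2: "simple_graph G2"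
    and reg1: "regular r1 G1" and reg2: "regular r2 G2"
    and us: "distinct us" "set us = verts G1" and ws: "distinct ws" "set ws = verts G2"
    and xs: "distinct xs" "set xs = verts (subdivision_vertex_join G1 G2)"
begin

abbreviation "vs \<equiv> map Inl us @ map Inr ws"
abbreviation "ks \<equiv> [0, 1, 2, 3 :: nat]"
abbreviation "sides \<equiv> [0, 1 :: nat]"

fun side :: "'a + 'b \<Rightarrow> nat" where
  "side (Inl u) = 0" | "side (Inr u) = 1"

definition deg :: "nat \<Rightarrow> complex" where
  "deg i = (if i = 0 then of_nat r1 else of_nat r2)"

definition size_block :: "nat \<Rightarrow> nat" where
  "size_block k = [card (verts G1), card (edges G1), card (verts G2), card (edges G2)] ! k"

text \<open>The columns of \<open>U\<close> are the indicator vectors of the four blocks, and \<open>N\<close> is the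
  vertex-by-end incidence matrix, so that \<open>D = - 2 N N\<^sup>T + U W\<close>. Column \<open>i\<close> of \<open>T\<close> indicates the
  vertices of the \<open>i\<close>-th graph; the span of the columns of \<open>U\<close> is invariant under
  \<open>- 2 N N\<^sup>T\<close>, which acts on it by the matrix \<open>K L\<close> of rank two.\<close>

definition D where "D = indexed_mat xs xs (\<lambda>x y. of_nat (join_dist x y) :: complex)"
definition N where "N = indexed_mat xs vs (\<lambda>x v. of_bool (v \<in> ends x) :: complex)"
definition N' where "N' = indexed_mat vs xs (\<lambda>v x. - 2 * of_bool (v \<in> ends x) :: complex)"
definition U where "U = indexed_mat xs ks (\<lambda>x k. of_bool (block x = k) :: complex)"
definition W where "W = indexed_mat ks xs (\<lambda>k x. of_nat (gap k (block x)) :: complex)"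
definition K where "K = indexed_mat ks sides
  (\<lambda>k i. of_bool (k div 2 = i) * (if odd k then 2 else 1) :: complex)"
definition L where "L = indexed_mat sides ks
  (\<lambda>i k. of_bool (k div 2 = i) * (- 2 * (if odd k then deg i else 1)))"
definition T where "T = indexed_mat vs sides (\<lambda>v i. of_bool (side v = i) :: complex)"

section \<open>Factorisation of the distance matrix and its invariant subspace\<close>

lemma carriers [simp]:
  "D \<in> carrier_mat (length xs) (length xs)"
  "N \<in> carrier_mat (length xs) (length us + length ws)"
  "N' \<in> carrier_mat (length us + length ws) (length xs)"
  "U \<in> carrier_mat (length xs) 4" "W \<in> carrier_mat 4 (length xs)"
  "K \<in> carrier_mat 4 2" "L \<in> carrier_mat 2 4" "T \<in> carrier_mat (length us + length ws) 2"
  unfolding D_def N_def N'_def U_def W_def K_def L_def T_def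
  by (rule carrier_matI; simp)+

lemma distinct_indices: "distinct ks" "distinct sides"
  by simp_all

lemma vs: "distinct vs" "set vs = verts G1 <+> verts G2"
  using us ws by (auto simp: distinct_map)

lemma finite_edges: "finite (verts G1)" "finite (verts G2)" "finite (edges G1)" "finite (edges G2)"
proof -
  have "edges G1 \<subseteq> Pow (verts G1)" "edges G2 \<subseteq> Pow (verts G2)"
    and fin: "finite (verts G1)" "finite (verts G2)"
    using G1 G2 by (auto simp: simple_graph_def)
  thus "finite (verts G1)" "finite (verts G2)" "finite (edges G1)" "finite (edges G2)"
    by (auto intro: finite_subset)
qed

lemma sum_xs:
  "(\<Sum>x\<in>set xs. f x) = (\<Sum>u\<in>verts G1. f (Inl (Inl u))) + (\<Sum>e\<in>edges G1. f (Inl (Inr e)))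
    + (\<Sum>u\<in>verts G2. f (Inr (Inl u))) + (\<Sum>e\<in>edges G2. f (Inr (Inr e)))"
  for f :: "_ \<Rightarrow> complex"
  unfolding xs(2) verts_join using finite_edges by (simp add: sum.Plus)

text \<open>This is \<open>join_dist_card\<close> solved for the distance: the sum over
  \<open>vs\<close> counts common ends with weight -2, and the sum over \<open>ks\<close> selects
  the block of \<open>x\<close>.\<close>

lemma D_eq: "D = N * N' + U * W"
proof -
  have "of_nat (join_dist x y) = (\<Sum>v\<in>set vs. of_bool (v \<in> ends x) * (- 2 * of_bool (v \<in> ends y)))
      + (\<Sum>k\<in>set ks. of_bool (block x = k) * complex_of_nat (gap k (block y)))"
    if "x \<in> set xs" "y \<in> set xs" for x y
  proof -
    have "ends x \<inter> ends y \<subseteq> set vs"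
      using ends_subset[OF G1 G2] that xs(2) vs(2) by blast
    hence 1: "(\<Sum>v\<in>set vs. of_bool (v \<in> ends x) * (- 2 * of_bool (v \<in> ends y)))
        = (\<Sum>v\<in>ends x \<inter> ends y. - 2 :: complex)"
      by (intro sum.mono_neutral_cong_right finite_set) auto
    have 2: "(\<Sum>k\<in>set ks. of_bool (block x = k) * complex_of_nat (gap k (block y)))
        = of_nat (gap (block x) (block y))"
      by (cases x rule: ends.cases) simp_all
    have 3: "complex_of_nat (gap (block x) (block y))
        = of_nat (join_dist x y) + 2 * of_nat (card (ends x \<inter> ends y))"
      using join_dist_card[OF G1 G2, of x y, THEN arg_cong[of _ _ complex_of_nat]] that
      by (simp add: xs(2))
    show ?thesis unfolding 1 2 3 by simp
  qed
  thus ?thesis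
    unfolding D_def N_def N'_def U_def W_def indexed_mat_mult[OF vs(1)]
      indexed_mat_mult[OF distinct_indices(1)] indexed_mat_add
    by (rule indexed_mat_cong)
qed

lemma sum_of_bool_conj:
  "finite A \<Longrightarrow> (\<Sum>x\<in>A. of_bool (P x) * c) = of_nat (card {x \<in> A. P x}) * (c :: complex)"
  by (simp add: of_bool_def if_distrib[of "\<lambda>t. t * c"] sum.If_cases Int_def cong: if_cong)

lemma sum_xs_of_bool:
  "(\<Sum>x\<in>set xs. of_bool (P x) * c) = of_nat
     (card {u \<in> verts G1. P (Inl (Inl u))} + card {e \<in> edges G1. P (Inl (Inr e))}
      + card {u \<in> verts G2. P (Inr (Inl u))} + card {e \<in> edges G2. P (Inr (Inr e))}) * (c :: complex)"
  unfolding sum_xs by (simp only: sum_of_bool_conj finite_edges of_nat_add distrib_right)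

text \<open>Regularity is what makes this work: the number of vertices in a block that have
  \<open>v\<close> as an end depends only on the side of \<open>v\<close>.\<close>

lemma N'U: "N' * U = T * L"
proof -
  have "(\<Sum>x\<in>set xs. - 2 * of_bool (v \<in> ends x) * of_bool (block x = k))
      = (\<Sum>i\<in>set sides. of_bool (side v = i) * (of_bool (k div 2 = i) * (- 2 * (if odd k then deg i else 1))))"
    if "v \<in> set vs" "k \<in> set ks" for v k
  proof -
    have count: "(\<Sum>x\<in>set xs. - 2 * of_bool (v \<in> ends x) * of_bool (block x = k))
      = of_nat (card {u \<in> verts G1. v \<in> ends (Inl (Inl u)) \<and> block (Inl (Inl u) :: ('a + 'a set) + ('b + 'b set)) = k}
        + card {e \<in> edges G1. v \<in> ends (Inl (Inr e)) \<and> block (Inl (Inr e) :: ('a + 'a set) + ('b + 'b set)) = k}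
        + card {u \<in> verts G2. v \<in> ends (Inr (Inl u)) \<and> block (Inr (Inl u) :: ('a + 'a set) + ('b + 'b set)) = k}
        + card {e \<in> edges G2. v \<in> ends (Inr (Inr e)) \<and> block (Inr (Inr e) :: ('a + 'a set) + ('b + 'b set)) = k})
        * (- 2 :: complex)"
      unfolding sum_xs_of_bool[where P = "\<lambda>x. v \<in> ends x \<and> block x = k", symmetric]
      by (rule sum.cong) auto
    show ?thesis
    proof (cases v)
  case (Inl u)
    hence u: "u \<in> verts G1" using that vs by auto
    \<comment> \<open>Among original vertices only \<open>u\<close> has the end \<open>u\<close>;
      among inserted ones, exactly those of the \<open>r1\<close> edges at \<open>u\<close>. The
      other graph contributes nothing.\<close>
    have "{x \<in> verts G1. x = u \<and> k = 0} = (if k = 0 then {u} else {})"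
      "{e \<in> edges G1. u \<in> e \<and> k = Suc 0} = (if k = Suc 0 then {e \<in> edges G1. u \<in> e} else {})"
      using u by auto
    moreover have "card {e \<in> edges G1. u \<in> e} = r1" using reg1 u by (simp add: regular_def)
    ultimately show ?thesis using that(2) unfolding count
      by (auto simp: Inl Inl_notin_Inr_image inj_image_mem_iff deg_def eq_commute[of u] eq_commute[of _ k])
    next
  case (Inr u)
    hence u: "u \<in> verts G2" using that vs by auto
    have "{x \<in> verts G2. x = u \<and> k = 2} = (if k = 2 then {u} else {})"
      "{e \<in> edges G2. u \<in> e \<and> k = Suc 2} = (if k = Suc 2 then {e \<in> edges G2. u \<in> e} else {})"
      using u by auto
    moreover have "card {e \<in> edges G2. u \<in> e} = r2" using reg2 u by (simp add: regular_def)
    ultimately show ?thesis using that(2) unfolding count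
      by (auto simp: Inr Inl_notin_Inr_image inj_image_mem_iff deg_def eq_commute[of u] eq_commute[of _ k])
    qed
  qed
  thus ?thesis
    unfolding N'_def U_def T_def L_def indexed_mat_mult[OF xs(1)] indexed_mat_mult[OF distinct_indices(2)]
    by (rule indexed_mat_cong)
qed

text \<open>All ends of a vertex lie on its own side, and their number, one or two, is determined by
  its block.\<close>

lemma NT: "N * T = U * K"
proof -
  have "(\<Sum>v\<in>set vs. of_bool (v \<in> ends x) * of_bool (side v = i))
      = (\<Sum>k\<in>set ks. of_bool (block x = k) * (of_bool (k div 2 = i) * (if odd k then 2 else 1 :: complex)))"
    if "x \<in> set xs" "i \<in> set sides" for x i
  proof -
    have "ends x \<subseteq> set vs"
      using ends_subset[OF G1 G2] that xs(2) vs(2) by blast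
    hence "(\<Sum>v\<in>set vs. of_bool (v \<in> ends x) * of_bool (side v = i))
        = (\<Sum>v\<in>ends x. of_bool (side v = i) :: complex)"
      by (intro sum.mono_neutral_cong_right finite_set) auto
    also have "\<dots> = (\<Sum>v\<in>ends x. of_bool (block x div 2 = i))"
      by (rule sum.cong) (cases x rule: ends.cases; auto)+
    also have "\<dots> = of_nat (card (ends x)) * of_bool (block x div 2 = i)" by simp
    also have "card (ends x) = (if odd (block x) then 2 else 1)"
      using that G1 G2 unfolding xs(2) verts_join
      by (cases x rule: ends.cases) (auto simp: card_image simple_graph_def)
    also have "of_nat \<dots> * of_bool (block x div 2 = i) = (\<Sum>k\<in>set ks. of_bool (block x = k) * (of_bool (k div 2 = i) * (if odd k then 2 else 1 :: complex)))"
      by (cases x rule: ends.cases) auto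
    finally show ?thesis .
  qed
  thus ?thesis
    unfolding N_def U_def T_def K_def indexed_mat_mult[OF vs(1)] indexed_mat_mult[OF distinct_indices(1)]
    by (rule indexed_mat_cong)
qed

lemma product_carriers:
  "N * N' \<in> carrier_mat (length xs) (length xs)"
  "N' * N \<in> carrier_mat (length us + length ws) (length us + length ws)"
  "L * K \<in> carrier_mat 2 2" "K * L \<in> carrier_mat 4 4" "W * U \<in> carrier_mat 4 4"
  by (rule mult_carrier_mat, rule carriers, rule carriers)+

lemma NN'_U: "N * N' * U = U * (K * L)"
proof -
  have "N * N' * U = N * (N' * U)" by (rule assoc_mult_mat) (rule carriers)+
  also have "\<dots> = N * (T * L)" by (simp add: N'U)
  also have "\<dots> = N * T * L" by (rule assoc_mult_mat[symmetric]) (rule carriers)+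
  also have "\<dots> = U * K * L" by (simp add: NT)
  also have "\<dots> = U * (K * L)" by (rule assoc_mult_mat) (rule carriers)+
  finally show ?thesis .
qed

lemma char_poly_D:
  "char_poly D * char_poly (K * L) = char_poly (N * N') * char_poly (K * L + W * U)"
  unfolding D_eq
  by (rule char_poly_invariant_update[OF product_carriers(1) carriers(4,5) product_carriers(4) NN'_U])

text \<open>An entry of \<open>N' * N\<close> is -2 times the number of join vertices having both
  given ends. On the diagonal these are the vertex itself and its incident edges,
  \<open>r + 1\<close> in all; off the diagonal, the edge joining the two, if any. Ends in different
  graphs share no vertex, which gives the block diagonal form.\<close>

lemma proots_N'N: "proots (char_poly (N' * N))
  = image_mset (\<lambda>z. - 2 * (of_nat r1 + 1) + - 2 * z) (adjacency_spectrum G1)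
  + image_mset (\<lambda>z. - 2 * (of_nat r2 + 1) + - 2 * z) (adjacency_spectrum G2)"
proof -
  define A where "A = indexed_mat us us (\<lambda>u v. complex_of_real (if {u, v} \<in> edges G1 then 1 else 0))"
  define B where "B = indexed_mat ws ws (\<lambda>u v. complex_of_real (if {u, v} \<in> edges G2 then 1 else 0))"
  define f where "f v w = (\<Sum>x\<in>set xs. - 2 * of_bool (v \<in> ends x) * of_bool (w \<in> ends x) :: complex)" for v w
  let ?A = "(- 2 * (of_nat r1 + 1)) \<cdot>\<^sub>m 1\<^sub>m (length us) + (- 2) \<cdot>\<^sub>m A"
  let ?B = "(- 2 * (of_nat r2 + 1)) \<cdot>\<^sub>m 1\<^sub>m (length ws) + (- 2) \<cdot>\<^sub>m B"
  have count: "f v w = of_nat (card {u \<in> verts G1. v \<in> ends (Inl (Inl u)) \<and> w \<in> ends (Inl (Inl u))}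
      + card {e \<in> edges G1. v \<in> ends (Inl (Inr e)) \<and> w \<in> ends (Inl (Inr e))}
      + card {u \<in> verts G2. v \<in> ends (Inr (Inl u)) \<and> w \<in> ends (Inr (Inl u))}
      + card {e \<in> edges G2. v \<in> ends (Inr (Inr e)) \<and> w \<in> ends (Inr (Inr e))}) * (- 2)" for v w
    unfolding f_def sum_xs_of_bool[where P = "\<lambda>x. v \<in> ends x \<and> w \<in> ends x", symmetric]
    by (rule sum.cong) auto
  \<comment> \<open>For \<open>u = v\<close> the set \<open>{u, v}\<close> is a singleton, so the
    diagonal adjacency entry is zero.\<close>
  have loop: "{v} \<notin> edges G1" "{w} \<notin> edges G2" for v w
    using G1 G2 by (auto simp: simple_graph_def)
  have f1: "f (Inl u) (Inl v) = (if u = v then - 2 * (of_nat r1 + 1) else 0)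
      + (- 2) * complex_of_real (if {u, v} \<in> edges G1 then 1 else 0)"
    if "u \<in> set us" "v \<in> set us" for u v
  proof -
    have uv: "u \<in> verts G1" "v \<in> verts G1" using that us by auto
    have "f (Inl u) (Inl v) = of_nat (card {x \<in> verts G1. x = u \<and> x = v}
        + card {e \<in> edges G1. u \<in> e \<and> v \<in> e}) * (- 2)"
      unfolding count by (simp add: Inl_notin_Inr_image inj_image_mem_iff eq_commute[of u] eq_commute[of v])
    also have "{x \<in> verts G1. x = u \<and> x = v} = (if u = v then {u} else {})" using uv by auto
    finally show ?thesis
      using card_edges_containing_pair[OF G1, of u v] reg1 uv loop by (auto simp: regular_def)
  qed
  have f2: "f (Inr u) (Inr v) = (if u = v then - 2 * (of_nat r2 + 1) else 0)
      + (- 2) * complex_of_real (if {u, v} \<in> edges G2 then 1 else 0)"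
    if "u \<in> set ws" "v \<in> set ws" for u v
  proof -
    have uv: "u \<in> verts G2" "v \<in> verts G2" using that ws by auto
    have "f (Inr u) (Inr v) = of_nat (card {x \<in> verts G2. x = u \<and> x = v}
        + card {e \<in> edges G2. u \<in> e \<and> v \<in> e}) * (- 2)"
      unfolding count by (simp add: Inl_notin_Inr_image inj_image_mem_iff eq_commute[of u] eq_commute[of v])
    also have "{x \<in> verts G2. x = u \<and> x = v} = (if u = v then {u} else {})" using uv by auto
    finally show ?thesis
      using card_edges_containing_pair[OF G2, of u v] reg2 uv loop by (auto simp: regular_def)
  qed
  have f3: "f (Inl u) (Inr v) = 0" "f (Inr v) (Inl u) = 0" for u v
    unfolding count by (simp_all add: image_iff)
  have AB: "A \<in> carrier_mat (length us) (length us)" "B \<in> carrier_mat (length ws) (length ws)"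
    by (simp_all add: A_def B_def)
  have "N' * N = indexed_mat vs vs f"
    unfolding N'_def N_def indexed_mat_mult[OF xs(1)] f_def ..
  also have "\<dots> = four_block_mat (indexed_mat us us (\<lambda>u v. f (Inl u) (Inl v))) (0\<^sub>m (length us) (length ws))
      (0\<^sub>m (length ws) (length us)) (indexed_mat ws ws (\<lambda>u v. f (Inr u) (Inr v)))"
    by (rule indexed_mat_sum_block_diag) (simp_all add: f3)
  also have "indexed_mat us us (\<lambda>u v. f (Inl u) (Inl v)) = ?A"
    unfolding A_def using us(1)
    by (intro eq_matI) (auto simp: indexed_mat_def f1 nth_eq_iff_index_eq)
  also have "indexed_mat ws ws (\<lambda>u v. f (Inr u) (Inr v)) = ?B"
    unfolding B_def using ws(1)
    by (intro eq_matI) (auto simp: indexed_mat_def f2 nth_eq_iff_index_eq)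
  finally have "char_poly (N' * N) = char_poly ?A * char_poly ?B"
    using AB by (simp add: char_poly_four_block_lower_triangular[of _ "length us" _ "length ws"])
  moreover have "char_poly ?A \<noteq> 0" "char_poly ?B \<noteq> 0"
    using AB by (auto intro!: char_poly_nonzero)
  ultimately have "proots (char_poly (N' * N)) = proots (char_poly ?A) + proots (char_poly ?B)"
    by (simp add: proots_mult)
  thus ?thesis
    unfolding proots_char_poly_affine[OF AB(1)] proots_char_poly_affine[OF AB(2)]
    unfolding A_def B_def adjacency_spectrum_def
    using us ws by (simp add: vertex_spectrum_eq)
qed

text \<open>\<open>L * K\<close> is diagonal since both factors respect sides. Its entries are the
  images of \<open>r1\<close> and \<open>r2\<close> under the two affine maps in
  \<open>proots_N'N\<close>, which is why they cancel later.\<close>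

lemma proots_LK: "proots (char_poly (L * K)) = {# - 2 * (1 + 2 * of_nat r1), - 2 * (1 + 2 * of_nat r2) #}"
proof -
  note LK = product_carriers(3)
  have e: "L * K = indexed_mat sides sides (\<lambda>i j. \<Sum>k\<in>set ks. of_bool (k div 2 = i) * (- 2 * (if odd k then deg i else 1)) *
      (of_bool (k div 2 = j) * (if odd k then 2 else 1)))"
    unfolding L_def K_def by (rule indexed_mat_mult) simp
  have "(L * K) $$ (0, 0) = - 2 * (1 + 2 * of_nat r1)" "(L * K) $$ (1, 1) = - 2 * (1 + 2 * of_nat r2)"
    "(L * K) $$ (1, 0) = 0"
    unfolding e by (simp_all add: indexed_mat_def deg_def)
  hence "upper_triangular (L * K)" "diag_mat (L * K) = [- 2 * (1 + 2 * of_nat r1), - 2 * (1 + 2 * of_nat r2)]"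
    using LK by (auto simp: upper_triangular_def diag_mat_def less_2_cases_iff upt_rec)
  with char_poly_upper_triangular[OF LK] show ?thesis
    by (simp only: proots_prod_list_linear) simp
qed

section \<open>Quotient matrix and assembly of the spectrum\<close>

lemma distance_spectrum_D: "distance_spectrum (subdivision_vertex_join G1 G2) = proots (char_poly D)"
  unfolding distance_spectrum_def vertex_spectrum_eq[OF xs] D_def
  using graph_dist_join[OF G1 G2] xs(2) by (intro arg_cong[of _ _ "\<lambda>M. proots (char_poly M)"] indexed_mat_cong) simp

lemma WU: "W * U = indexed_mat ks ks (\<lambda>k l. of_nat (gap k l) * of_nat (size_block l))"
proof -
  have "(\<Sum>x\<in>set xs. of_nat (gap k (block x)) * of_bool (block x = l)) = complex_of_nat (gap k l) * of_nat (size_block l)"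
    if "l \<in> set ks" for k l
    using that unfolding sum_xs by (auto simp: size_block_def)
  thus ?thesis
    unfolding W_def U_def indexed_mat_mult[OF xs(1)] by (rule indexed_mat_cong)
qed

text \<open>The quotient matrix of \<open>D\<close> for the partition into blocks: its entries are
  the distance sums from one vertex of a block to a whole block.\<close>

lemma KL_WU:
  defines "p1 \<equiv> card (verts G1)" and "p2 \<equiv> card (verts G2)"
  shows "K * L + W * U = map_mat complex_of_real (mat_of_rows_list 4
        [[2 * real p1 - 2, 3 / 2 * real r1 * real p1 - 2 * real r1,
            real p2, real r2 * real p2],
         [3 * real p1 - 4, 2 * real r1 * real p1 - 4 * real r1,
            2 * real p2, 3 / 2 * real r2 * real p2],
         [real p1, real r1 * real p1,
            2 * real p2 - 2, 3 / 2 * real r2 * real p2 - 2 * real r2],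
         [2 * real p1, 3 / 2 * real r1 * real p1,
            3 * real p2 - 4, 2 * real r2 * real p2 - 4 * real r2]])"
    (is "_ = ?Q")
proof -
  have m: "of_nat (card (edges G1)) = of_nat r1 * of_nat p1 / (2 :: complex)"
    "of_nat (card (edges G2)) = of_nat r2 * of_nat p2 / (2 :: complex)"
    using handshake[OF G1 reg1, THEN arg_cong[of _ _ complex_of_nat]]
      handshake[OF G2 reg2, THEN arg_cong[of _ _ complex_of_nat]]
    by (simp_all add: p1_def p2_def field_simps)
  have KL: "K * L = indexed_mat ks ks (\<lambda>k l. \<Sum>i\<in>set sides.
      of_bool (k div 2 = i) * (if odd k then 2 else 1) * (of_bool (l div 2 = i) * (- 2 * (if odd l then deg i else 1))))"
    unfolding L_def K_def by (rule indexed_mat_mult) simp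
  show ?thesis
    unfolding KL WU indexed_mat_add
  proof (rule eq_matI)
    fix i j assume "i < dim_row ?Q" "j < dim_col ?Q"
    hence "i \<in> {0, 1, 2, 3}" "j \<in> {0, 1, 2, 3}" by (auto simp: mat_of_rows_list_def)
    thus "indexed_mat ks ks (\<lambda>k l. (\<Sum>i\<in>set sides.
      of_bool (k div 2 = i) * (if odd k then 2 else 1) * (of_bool (l div 2 = i) * (- 2 * (if odd l then deg i else 1))))
      + of_nat (gap k l) * of_nat (size_block l)) $$ (i, j) = ?Q $$ (i, j)"
      by (auto simp: indexed_mat_def mat_of_rows_list_def gap_def size_block_def deg_def
          m p1_def[symmetric] p2_def[symmetric] field_simps)
  qed (auto simp: mat_of_rows_list_def)
qed

lemma length_lists:
  "length us = card (verts G1)" "length ws = card (verts G2)"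
  "length xs = card (verts G1) + card (edges G1) + (card (verts G2) + card (edges G2))"
  using distinct_card[OF us(1)] distinct_card[OF ws(1)] distinct_card[OF xs(1)] finite_edges
  by (simp_all add: us(2) ws(2) xs(2) verts_join card_Plus)

text \<open>Root multisets of both sides of \<open>char_poly_D\<close>. The eigenvalues of
  \<open>K * L\<close> stay on the left, so no multiset difference is needed.\<close>

lemma proots_distance:
  "distance_spectrum (subdivision_vertex_join G1 G2)
    + {# 0, 0, - 2 * (1 + 2 * of_nat r1), - 2 * (1 + 2 * of_nat r2) #}
   = replicate_mset (card (edges G1) + card (edges G2)) 0
    + image_mset (\<lambda>z. - 2 * (of_nat r1 + 1) + - 2 * z) (adjacency_spectrum G1)
    + image_mset (\<lambda>z. - 2 * (of_nat r2 + 1) + - 2 * z) (adjacency_spectrum G2)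
    + proots (char_poly (K * L + W * U))"
proof -
  let ?v = "length us + length ws" and ?n = "length xs"
  have nz: "char_poly (K * L) \<noteq> 0" "char_poly (L * K) \<noteq> 0" "char_poly (N * N') \<noteq> 0"
    "char_poly (N' * N) \<noteq> 0" "char_poly (K * L + W * U) \<noteq> 0" "char_poly D \<noteq> 0"
    using product_carriers[THEN char_poly_nonzero] carriers(1)[THEN char_poly_nonzero]
      add_carrier_mat[OF product_carriers(5), THEN char_poly_nonzero] by auto
  \<comment> \<open>\<open>K * L\<close> has order 4 and \<open>L * K\<close> order 2, hence two
    additional zeros.\<close>
  have "proots (char_poly (K * L)) + replicate_mset 2 0 = replicate_mset 4 0 + proots (char_poly (L * K))"
    using arg_cong[OF char_poly_mult_commute[OF carriers(6,7)], of proots] nz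
    by (simp add: proots_mult proots_monom)
  hence 1: "proots (char_poly (K * L)) = {# 0, 0, - 2 * (1 + 2 * of_nat r1), - 2 * (1 + 2 * of_nat r2) #}"
    by (simp add: proots_LK numeral_eq_Suc)
  have "proots (char_poly (N * N')) + replicate_mset ?v 0 = replicate_mset ?n 0 + proots (char_poly (N' * N))"
    using arg_cong[OF char_poly_mult_commute[OF carriers(2,3)], of proots] nz
    by (simp add: proots_mult proots_monom)
  \<comment> \<open>The join has one vertex for each end and one more for each edge, so the surplus
    of zeros is the number of edges.\<close>
  also have "replicate_mset ?n 0 = replicate_mset ?v 0 + replicate_mset (card (edges G1) + card (edges G2)) (0::complex)"
    by (simp add: length_lists multiset_eq_iff)
  finally have 2: "proots (char_poly (N * N')) = replicate_mset (card (edges G1) + card (edges G2)) 0 + proots (char_poly (N' * N))"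
    by simp
  have "proots (char_poly D) + proots (char_poly (K * L)) = proots (char_poly (N * N')) + proots (char_poly (K * L + W * U))"
    using arg_cong[OF char_poly_D, of proots] nz by (simp add: proots_mult)
  thus ?thesis unfolding 1 2 proots_N'N distance_spectrum_D by (simp only: ac_simps)
qed

end

text \<open>Multiplicities are compared as real numbers because the contribution at 0 is a
  difference that can be negative: it is -2 for two edgeless graphs.\<close>

theorem theorem3p20:
  fixes G1 :: "'a graph" and G2 :: "'b graph"
    and r1 r2 p1 p2 :: nat and lam1 lam2 :: "nat \<Rightarrow> complex"
  assumes "simple_graph G1" and "regular r1 G1" and "card (verts G1) = p1"
    and "adjacency_spectrum G1 = add_mset (of_nat r1) (image_mset lam1 (mset_set {2..p1}))"
    and "simple_graph G2" and "regular r2 G2" and "card (verts G2) = p2"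
    and "adjacency_spectrum G2 = add_mset (of_nat r2) (image_mset lam2 (mset_set {2..p2}))"
  shows "\<forall>x :: complex.
    real (count (distance_spectrum (subdivision_vertex_join G1 G2)) x) =
      real (count (image_mset (\<lambda>j. - 2 * (lam1 j + of_nat r1 + 1)) (mset_set {2..p1})) x)
    + real (count (image_mset (\<lambda>j. - 2 * (lam2 j + of_nat r2 + 1)) (mset_set {2..p2})) x)
    + (if x = 0 then 1 / 2 * real r1 * real p1 + 1 / 2 * real r2 * real p2 - 2 else 0)
    + real (count (eigenvalue_mset (mat_of_rows_list 4
        [[2 * real p1 - 2, 3 / 2 * real r1 * real p1 - 2 * real r1,
            real p2, real r2 * real p2],
         [3 * real p1 - 4, 2 * real r1 * real p1 - 4 * real r1,
            2 * real p2, 3 / 2 * real r2 * real p2],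
         [real p1, real r1 * real p1,
            2 * real p2 - 2, 3 / 2 * real r2 * real p2 - 2 * real r2],
         [2 * real p1, 3 / 2 * real r1 * real p1,
            3 * real p2 - 4, 2 * real r2 * real p2 - 4 * real r2]])) x)"
    (is "\<forall>x. real (count ?D x) = real (count ?L1 x) + real (count ?L2 x) + ?z x + real (count (eigenvalue_mset ?Q) x)")
proof
  fix x
  have fin: "finite (verts G1)" "finite (verts G2)"
    and sub: "edges G1 \<subseteq> Pow (verts G1)" "edges G2 \<subseteq> Pow (verts G2)"
    using assms(1,5) by (auto simp: simple_graph_def)
  have "finite (verts (subdivision_vertex_join G1 G2))"
    unfolding verts_join using fin sub by (auto intro!: finite_Plus intro: finite_subset)
  then obtain us ws xs where "distinct us" "set us = verts G1" "distinct ws" "set ws = verts G2"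
    "distinct xs" "set xs = verts (subdivision_vertex_join G1 G2)"
    using fin finite_distinct_list by metis
  then interpret regular_pair G1 G2 r1 r2 us ws xs
    using assms by unfold_locales auto
  have Q: "proots (char_poly (K * L + W * U)) = eigenvalue_mset ?Q"
    unfolding eigenvalue_mset_def KL_WU assms(3,7) ..
  \<comment> \<open>The distinguished eigenvalues \<open>r1\<close> and \<open>r2\<close> are split
    off; their images are the two nonzero eigenvalues on the left of
    \<open>proots_distance\<close>.\<close>
  have "image_mset (\<lambda>z. - 2 * (of_nat r1 + 1) + - 2 * z) (adjacency_spectrum G1)
      = add_mset (- 2 * (1 + 2 * of_nat r1)) ?L1"
    "image_mset (\<lambda>z. - 2 * (of_nat r2 + 1) + - 2 * z) (adjacency_spectrum G2)
      = add_mset (- 2 * (1 + 2 * of_nat r2)) ?L2"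
    unfolding assms(4,8) by (simp_all add: multiset.map_comp o_def algebra_simps)
  with proots_distance
  have "?D + {# 0, 0 #} = replicate_mset (card (edges G1) + card (edges G2)) 0 + ?L1 + ?L2 + eigenvalue_mset ?Q"
    by (simp add: Q)
  from arg_cong[OF this, of "\<lambda>M. real (count M x)"]
  have "real (count ?D x) + (if x = 0 then 2 else 0) = (if x = 0 then real (card (edges G1) + card (edges G2)) else 0)
      + real (count ?L1 x) + real (count ?L2 x) + real (count (eigenvalue_mset ?Q) x)"
    by (simp split: if_splits)
  moreover have "real (card (edges G1)) = 1 / 2 * real r1 * real p1" "real (card (edges G2)) = 1 / 2 * real r2 * real p2"
    using handshake[OF assms(1,2), THEN arg_cong[of _ _ real]]
      handshake[OF assms(5,6), THEN arg_cong[of _ _ real]] assms(3,7) by simp_all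
  ultimately show "real (count ?D x) = real (count ?L1 x) + real (count ?L2 x) + ?z x + real (count (eigenvalue_mset ?Q) x)"
    by (simp split: if_splits)
qed

end
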